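(* Let $\theta\in(0,\pi)$ and $r>0$. The Wulff ball $\mathcal{W}_{r,\theta}$ of radius $r$ centered at the origin, with respect to the capillary gauge $F_\theta(\xi)=|\xi|-\cos\theta\,\langle\xi,E_n\rangle$ on $\mathbb{R}^n$, is given by $B_r(-r\cos\theta\,E_n)$, the Euclidean ball of radius $r$ centered at $-r\cos\theta\,E_n$. In particular, $\partial\mathcal{W}_{r,\theta}$ intersects the hyperplane $\partial\mathbb{R}^n_+=\{x_n=0\}$ at the contact angle $\theta$.
   Context: $E_n=(0,\dots,0,1)$; $\mathbb{R}^n_+=\{x\in\mathbb{R}^n:\langle x,E_n\rangle>0\}$. The dual gauge is $F_\theta^o(x)=\sup\{\langle x,z\rangle/F_\theta(z): z\in\mathbb{S}^{n-1}\}$, and the Wulff ball of radius $r$ centered at the origin is $\mathcal{W}_{r,\theta}=\{x\in\mathbb{R}^n:F_\theta^o(x)<r\}$. That $\partial\mathcal{W}_{r,\theta}$ intersects $\{x_n=0\}$ at the contact angle $\theta$ means that at each point $z\in\partial\mathcal{W}_{r,\theta}\cap\{x_n=0\}$ the outward unit normal $\nu(z)$ of $\mathcal{W}_{r,\theta}$ satisfies $\langle\nu(z),E_n\rangle=\cos\theta$. *)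

theory Defs
  imports "HOL-Analysis.Analysis"
begin

text \<open>
  \<open>\<real>\<^sup>n\<close> is \<^typ>\<open>real ^ 'n\<close> over a finite linearly ordered index type, so that
  there is a last coordinate.
\<close>

definition E\<^sub>n :: "real ^ 'n::{finite,linorder}"
  where "E\<^sub>n = axis (Max UNIV) 1"

definition upper_halfspace :: "(real ^ 'n::{finite,linorder}) set"
  where "upper_halfspace = {x. x \<bullet> E\<^sub>n > 0}"

lemma frontier_upper_halfspace:
  "frontier upper_halfspace = {x :: real ^ 'n::{finite,linorder}. x $ Max UNIV = 0}"
proof -
  have "E\<^sub>n \<noteq> (0 :: real ^ 'n::{finite,linorder})"
    by (simp add: E\<^sub>n_def axis_eq_0_iff)
  then have "frontier {x. E\<^sub>n \<bullet> x > (0::real)} = {x :: real ^ 'n::{finite,linorder}. E\<^sub>n \<bullet> x = 0}"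
    by (intro frontier_halfspace_gt) simp
  then show ?thesis
    by (simp add: upper_halfspace_def inner_commute E\<^sub>n_def inner_axis)
qed

definition capillary_gauge :: "real \<Rightarrow> real ^ 'n::{finite,linorder} \<Rightarrow> real"
  where "capillary_gauge \<theta> \<xi> = norm \<xi> - cos \<theta> * (\<xi> \<bullet> E\<^sub>n)"

definition dual_gauge :: "('a::euclidean_space \<Rightarrow> real) \<Rightarrow> 'a \<Rightarrow> real"
  where "dual_gauge F x = (SUP z \<in> sphere 0 1. (x \<bullet> z) / F z)"

definition wulff_ball :: "('a::euclidean_space \<Rightarrow> real) \<Rightarrow> real \<Rightarrow> 'a set"
  where "wulff_ball F r = {x. dual_gauge F x < r}"

text \<open>
  \<open>\<nu>\<close> is an outward unit normal of \<open>S\<close> at the boundary point \<open>z\<close> if \<open>S\<close> is, near \<open>z\<close>,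
  the sublevel set \<open>{\<phi> < 0}\<close> of a \<open>C\<^sup>1\<close> function \<open>\<phi>\<close> with \<open>\<phi> z = 0\<close> whose gradient \<open>g\<close>
  does not vanish at \<open>z\<close>, and \<open>\<nu>\<close> is the normalized gradient \<open>g z / \<bar>g z\<bar> = sgn (g z)\<close>.
\<close>

definition outward_unit_normal :: "'a::euclidean_space set \<Rightarrow> 'a \<Rightarrow> 'a \<Rightarrow> bool"
  where "outward_unit_normal S z \<nu> \<longleftrightarrow>
    (\<exists>U (\<phi> :: 'a \<Rightarrow> real) g.
        open U \<and> z \<in> U \<and>
        (\<forall>x\<in>U. (\<phi> has_derivative (\<lambda>h. g x \<bullet> h)) (at x)) \<and>
        continuous_on U g \<and>
        \<phi> z = 0 \<and> g z \<noteq> 0 \<and>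
        S \<inter> U = {x \<in> U. \<phi> x < 0} \<and>
        \<nu> = sgn (g z))"

text \<open>
  The existence clause says that \<open>S\<close> has a normal at each such point; without it the condition
  on the normals would be vacuous where the boundary is not \<open>C\<^sup>1\<close>.
\<close>

definition contact_angle :: "(real ^ 'n::{finite,linorder}) set \<Rightarrow> real \<Rightarrow> bool"
  where "contact_angle S \<theta> \<longleftrightarrow>
    (\<forall>z \<in> frontier S \<inter> frontier upper_halfspace.
        (\<exists>\<nu>. outward_unit_normal S z \<nu>) \<and>
        (\<forall>\<nu>. outward_unit_normal S z \<nu> \<longrightarrow> \<nu> \<bullet> E\<^sub>n = cos \<theta>))"

end

theory Submission
  imports Defs
begin

text \<open>
  As \<open>F\<^sub>\<theta>\<close> is positive and continuous on the unit sphere, the supremum defining \<open>F\<^sub>\<theta>\<^sup>o x\<close>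
  is attained, so \<open>F\<^sub>\<theta>\<^sup>o x < r\<close> means \<open>x \<bullet> z < r (1 - cos \<theta> (z \<bullet> E\<^sub>n))\<close>, that is
  \<open>(x + r cos \<theta> E\<^sub>n) \<bullet> z < r\<close>, for all unit vectors \<open>z\<close>; this says
  \<open>norm (x + r cos \<theta> E\<^sub>n) < r\<close>. The outward unit normal of this ball at \<open>z\<close> is
  \<open>(z + r cos \<theta> E\<^sub>n) / r\<close>, whose last coordinate is \<open>cos \<theta>\<close> when that of \<open>z\<close> vanishes.
\<close>

text \<open>One direction is Cauchy-Schwarz; the other tests with \<open>sgn y\<close>, where
  equality holds. The case \<open>y = 0\<close> rests on \<open>r > 0\<close>.\<close>

lemma norm_less_iff_inner_sphere:
  fixes y :: "'a::euclidean_space"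
  assumes "r > 0"
  shows "norm y < r \<longleftrightarrow> (\<forall>z\<in>sphere 0 1. y \<bullet> z < r)"
proof
  assume *: "norm y < r"
  show "\<forall>z\<in>sphere 0 1. y \<bullet> z < r"
  proof
    fix z :: 'a
    assume "z \<in> sphere 0 1"
    then show "y \<bullet> z < r"
      using norm_cauchy_schwarz[of y z] * by simp
  qed
next
  assume *: "\<forall>z\<in>sphere 0 1. y \<bullet> z < r"
  show "norm y < r"
  proof (cases "y = 0")
    case False
    then have "y \<bullet> sgn y = norm y"
      by (simp add: sgn_div_norm dot_square_norm power2_eq_square)
    moreover have "sgn y \<in> sphere 0 1"
      using False by (simp add: norm_sgn)
    ultimately show ?thesis
      using * by force
  qed (use assms in simp)
qed

text \<open>In general a strict pointwise bound gives only a weak bound on a supremum. Compactness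
  of the sphere makes the supremum a maximum, so strictness survives; positivity of \<open>F\<close>
  then clears the denominator.\<close>

lemma dual_gauge_less_iff:
  fixes F :: "'a::euclidean_space \<Rightarrow> real"
  assumes "continuous_on (sphere 0 1) F" and pos: "\<And>z. z \<in> sphere 0 1 \<Longrightarrow> F z > 0"
  shows "dual_gauge F x < r \<longleftrightarrow> (\<forall>z\<in>sphere 0 1. x \<bullet> z < r * F z)"
proof -
  let ?f = "\<lambda>z. (x \<bullet> z) / F z"
  have "continuous_on (sphere 0 1) ?f"
    using assms by (intro continuous_intros) force+
  moreover have "sphere (0::'a) 1 \<noteq> {}"
    by simp
  ultimately obtain z0 where z0: "z0 \<in> sphere 0 1" "\<And>z. z \<in> sphere 0 1 \<Longrightarrow> ?f z \<le> ?f z0"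
    using continuous_attains_sup[OF compact_sphere] by blast
  then have "dual_gauge F x = ?f z0"
    unfolding dual_gauge_def by (intro cSup_eq_maximum) auto
  then have "dual_gauge F x < r \<longleftrightarrow> (\<forall>z\<in>sphere 0 1. ?f z < r)"
    using z0(1) order_le_less_trans[OF z0(2)] by auto
  also have "\<dots> \<longleftrightarrow> (\<forall>z\<in>sphere 0 1. x \<bullet> z < r * F z)"
    using pos by (intro ball_cong) (simp_all add: pos_divide_less_eq)
  finally show ?thesis .
qed

lemma norm_E\<^sub>n [simp]: "norm (E\<^sub>n :: real ^ 'n::{finite,linorder}) = 1"
  by (simp add: E\<^sub>n_def)

text \<open>Cauchy-Schwarz against the unit vector \<open>E\<^sub>n\<close> bounds the linear term
  by \<open>\<bar>cos \<theta>\<bar> * norm z\<close>, which is strictly below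
  \<open>norm z\<close>.\<close>

lemma capillary_gauge_pos:
  fixes z :: "real ^ 'n::{finite,linorder}"
  assumes "\<bar>cos \<theta>\<bar> < 1" and "z \<noteq> 0"
  shows "capillary_gauge \<theta> z > 0"
proof -
  have "cos \<theta> * (z \<bullet> E\<^sub>n) \<le> \<bar>cos \<theta>\<bar> * \<bar>z \<bullet> E\<^sub>n\<bar>"
    by (simp flip: abs_mult)
  also have "\<dots> \<le> \<bar>cos \<theta>\<bar> * norm z"
    using Cauchy_Schwarz_ineq2[of z E\<^sub>n] by (intro mult_left_mono) auto
  also have "\<dots> < norm z"
    using assms by simp
  finally show ?thesis
    by (simp add: capillary_gauge_def)
qed

lemma wulff_ball_capillary_gauge:
  assumes "\<bar>cos \<theta>\<bar> < 1" and "r > 0"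
  shows "wulff_ball (capillary_gauge \<theta>) r =
    ball (- (r * cos \<theta>) *\<^sub>R (E\<^sub>n :: real ^ 'n::{finite,linorder})) r"
proof -
  have "dual_gauge (capillary_gauge \<theta>) x < r \<longleftrightarrow> dist (- (r * cos \<theta>) *\<^sub>R E\<^sub>n) x < r"
    for x :: "real ^ 'n::{finite,linorder}"
  proof -
    have "continuous_on (sphere 0 1) (capillary_gauge \<theta> :: real ^ 'n::{finite,linorder} \<Rightarrow> real)"
      unfolding capillary_gauge_def by (intro continuous_intros)
    then have "dual_gauge (capillary_gauge \<theta>) x < r \<longleftrightarrow>
        (\<forall>z\<in>sphere 0 1. x \<bullet> z < r * capillary_gauge \<theta> z)"
      using assms(1) by (intro dual_gauge_less_iff capillary_gauge_pos) auto
    also have "\<dots> \<longleftrightarrow> (\<forall>z\<in>sphere 0 1. (x + (r * cos \<theta>) *\<^sub>R E\<^sub>n) \<bullet> z < r)"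
    proof (intro ball_cong refl)
      fix z :: "real ^ 'n::{finite,linorder}"
      assume "z \<in> sphere 0 1"
      then have "r * capillary_gauge \<theta> z = r - (r * cos \<theta>) * (E\<^sub>n \<bullet> z)"
        by (simp add: capillary_gauge_def inner_commute[of z] right_diff_distrib)
      then show "x \<bullet> z < r * capillary_gauge \<theta> z \<longleftrightarrow> (x + (r * cos \<theta>) *\<^sub>R E\<^sub>n) \<bullet> z < r"
        by (simp add: inner_left_distrib less_diff_eq)
    qed
    also have "\<dots> \<longleftrightarrow> norm (x + (r * cos \<theta>) *\<^sub>R E\<^sub>n) < r"
      using norm_less_iff_inner_sphere[OF assms(2)] by blast
    also have "\<dots> \<longleftrightarrow> dist (- (r * cos \<theta>) *\<^sub>R E\<^sub>n) x < r"
      by (subst dist_commute) (simp add: dist_norm)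
    finally show ?thesis .
  qed
  then show ?thesis
    by (simp only: wulff_ball_def ball_def)
qed

lemma has_derivative_along_line:
  fixes \<phi> :: "'a::real_inner \<Rightarrow> real"
  assumes "(\<phi> has_derivative (\<lambda>h. g \<bullet> h)) (at z)"
  shows "((\<lambda>t. \<phi> (z + t *\<^sub>R h)) has_real_derivative g \<bullet> h) (at 0)"
proof -
  have "((\<lambda>t. z + t *\<^sub>R h) has_derivative (\<lambda>t. t *\<^sub>R h)) (at 0)"
    by (auto intro!: derivative_eq_intros)
  \<comment> \<open>The base point is written as the value of the line at parameter 0, the form the
    chain rule expects.\<close>
  moreover have "(\<phi> has_derivative (\<lambda>h. g \<bullet> h)) (at (z + 0 *\<^sub>R h))"
    using assms by simp
  ultimately have "((\<lambda>t. \<phi> (z + t *\<^sub>R h)) has_derivative (\<lambda>t. g \<bullet> (t *\<^sub>R h))) (at 0)"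
    by (rule has_derivative_compose)
  moreover have "(\<lambda>t. g \<bullet> (t *\<^sub>R h)) = (*) (g \<bullet> h)"
    by (rule ext) simp
  ultimately show ?thesis
    by (simp only: has_field_derivative_def)
qed

lemma eventually_line_in_open:
  fixes z :: "'a::real_normed_vector"
  assumes "open U" and "z \<in> U"
  shows "\<forall>\<^sub>F t in at_right 0. z + t *\<^sub>R h \<in> U"
proof -
  have "((\<lambda>t. z + t *\<^sub>R h) \<longlongrightarrow> z + 0 *\<^sub>R h) (at_right 0)"
    by (intro tendsto_intros)
  then show ?thesis
    by (rule topological_tendstoD) (use assms in simp_all)
qed

text \<open>A direction making an obtuse angle with the gradient leads from \<open>z\<close>
  straight into the sublevel set: the restriction of \<open>\<phi>\<close> to the ray has negative
  slope at 0.\<close>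

lemma eventually_line_neg:
  fixes \<phi> :: "'a::real_inner \<Rightarrow> real"
  assumes "(\<phi> has_derivative (\<lambda>h. g \<bullet> h)) (at z)" and "\<phi> z = 0" and "g \<bullet> h < 0"
  shows "\<forall>\<^sub>F t in at_right 0. \<phi> (z + t *\<^sub>R h) < 0"
  using DERIV_neg_dec_right[OF has_derivative_along_line[OF assms(1)] assms(3)] assms(2)
  by (auto simp: eventually_at_right_field)

lemma sgn_eqI_half_spaces:
  fixes a b :: "'a::real_inner"
  assumes "a \<noteq> 0" and "b \<noteq> 0" and imp: "\<And>h. a \<bullet> h < 0 \<Longrightarrow> b \<bullet> h \<le> 0"
  shows "sgn a = sgn b"
proof -
  \<comment> \<open>If the directions differ, this \<open>h\<close> separates the two half-spaces by strict Cauchy-Schwarz.\<close>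
  define h where "h = norm a *\<^sub>R b - norm b *\<^sub>R a"
  have "a \<bullet> h = norm a * (a \<bullet> b - norm a * norm b)"
    by (simp add: h_def inner_diff_right dot_square_norm power2_eq_square algebra_simps)
  moreover have "b \<bullet> h = norm b * (norm a * norm b - a \<bullet> b)"
    by (simp add: h_def inner_diff_right dot_square_norm power2_eq_square inner_commute algebra_simps)
  ultimately have "\<not> a \<bullet> b < norm a * norm b"
    using imp[of h] assms(1,2) by (auto simp: mult_less_0_iff mult_le_0_iff)
  then have "a \<bullet> b = norm a * norm b"
    using norm_cauchy_schwarz[of a b] by linarith
  then have "norm a *\<^sub>R b = norm b *\<^sub>R a"
    by (simp add: norm_cauchy_schwarz_eq)
  then have "sgn (norm a *\<^sub>R b) = sgn (norm b *\<^sub>R a)"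
    by simp
  then show ?thesis
    using assms(1,2) by (simp add: sgn_scaleR)
qed

text \<open>The definition admits any local defining function, so independence of that choice has to
  be shown. A ray with \<open>g z \<bullet> h < 0\<close> starts inside \<open>S\<close>, which
  forces \<open>k z \<bullet> h \<le> 0\<close>; this inclusion of half-spaces fixes the direction
  of the gradient.\<close>

lemma outward_unit_normal_unique:
  assumes "outward_unit_normal S z \<nu>" and "outward_unit_normal S z \<nu>'"
  shows "\<nu> = \<nu>'"
proof -
  obtain U \<phi> g where U: "open U" "z \<in> U" "(\<phi> has_derivative (\<lambda>h. g z \<bullet> h)) (at z)" "\<phi> z = 0"
      "g z \<noteq> 0" "S \<inter> U = {x \<in> U. \<phi> x < 0}" "\<nu> = sgn (g z)"
    using assms(1) unfolding outward_unit_normal_def by blast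
  obtain V \<psi> k where V: "open V" "z \<in> V" "(\<psi> has_derivative (\<lambda>h. k z \<bullet> h)) (at z)" "\<psi> z = 0"
      "k z \<noteq> 0" "S \<inter> V = {x \<in> V. \<psi> x < 0}" "\<nu>' = sgn (k z)"
    using assms(2) unfolding outward_unit_normal_def by blast
  have "k z \<bullet> h \<le> 0" if "g z \<bullet> h < 0" for h
  proof (rule ccontr)
    assume "\<not> k z \<bullet> h \<le> 0"
    \<comment> \<open>With the sign of \<open>\<psi>\<close> reversed, the same ray lemma shows that
      the ray starts where \<open>\<psi>\<close> is positive, hence outside
      \<open>S\<close>.\<close>
    then have "((\<lambda>x. - \<psi> x) has_derivative (\<lambda>h. - k z \<bullet> h)) (at z)" "- k z \<bullet> h < 0"
      using has_derivative_minus[OF V(3)] by auto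
    then have "\<forall>\<^sub>F t in at_right 0. - \<psi> (z + t *\<^sub>R h) < 0"
      using V(4) by (intro eventually_line_neg[where \<phi> = "\<lambda>x. - \<psi> x" and g = "- k z"]) auto
    moreover have "\<forall>\<^sub>F t in at_right 0. \<phi> (z + t *\<^sub>R h) < 0"
      using U(3,4) that by (rule eventually_line_neg)
    moreover note eventually_line_in_open[OF U(1,2), of h] eventually_line_in_open[OF V(1,2), of h]
    \<comment> \<open>For small positive \<open>t\<close> the point lies in both \<open>U\<close>
      and \<open>V\<close>, where the two descriptions of \<open>S\<close> conflict.\<close>
    ultimately have "\<forall>\<^sub>F t in at_right (0::real). False"
    proof eventually_elim
      case (elim t)
      have "z + t *\<^sub>R h \<in> S"
        using U(6) elim by blast
      then have "\<psi> (z + t *\<^sub>R h) < 0"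
        using V(6) elim by blast
      then show ?case
        using elim by simp
    qed
    then show False
      by simp
  qed
  then show ?thesis
    using sgn_eqI_half_spaces U(5,7) V(5,7) by blast
qed

lemma outward_unit_normal_ball:
  fixes a z :: "'a::euclidean_space"
  assumes "r > 0" and "z \<in> sphere a r"
  shows "outward_unit_normal (ball a r) z (sgn (z - a))"
  unfolding outward_unit_normal_def
proof (intro exI conjI ballI)
  \<comment> \<open>The squared distance is smooth even at the centre, so the whole space serves as
    the neighbourhood; \<open>sgn\<close> absorbs the factor 2 of the gradient.\<close>
  let ?\<phi> = "\<lambda>x. (x - a) \<bullet> (x - a) - r\<^sup>2" and ?g = "\<lambda>x. 2 *\<^sub>R (x - a)"
  show "(?\<phi> has_derivative (\<lambda>h. ?g x \<bullet> h)) (at x)" for x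
    by (auto intro!: derivative_eq_intros simp: inner_commute)
  show "continuous_on UNIV ?g"
    by (intro continuous_intros)
  have z: "norm (z - a) = r"
    using assms(2) by (simp add: dist_norm norm_minus_commute)
  then show "?\<phi> z = 0"
    by (simp add: dot_square_norm)
  show "?g z \<noteq> 0"
    using z assms(1) by auto
  have "x \<in> ball a r \<longleftrightarrow> ?\<phi> x < 0" for x
    using assms(1) norm_lt_square[of "x - a" r] by (simp add: dist_norm norm_minus_commute)
  then show "ball a r \<inter> UNIV = {x \<in> UNIV. ?\<phi> x < 0}"
    by blast
  show "sgn (z - a) = sgn (?g z)"
    by (simp add: sgn_scaleR)
qed auto

lemma contact_angle_ball:
  assumes "r > 0"
  shows "contact_angle (ball (- (r * cos \<theta>) *\<^sub>R (E\<^sub>n :: real ^ 'n::{finite,linorder})) r) \<theta>"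
  unfolding contact_angle_def
proof (rule ballI)
  let ?a = "- (r * cos \<theta>) *\<^sub>R (E\<^sub>n :: real ^ 'n::{finite,linorder})"
  fix z assume z: "z \<in> frontier (ball ?a r) \<inter> frontier upper_halfspace"
  then have sphere: "z \<in> sphere ?a r"
    using frontier_ball[OF assms] by blast
  have "z \<bullet> E\<^sub>n = 0"
    using z by (simp add: frontier_upper_halfspace E\<^sub>n_def inner_axis)
  then have "(z - ?a) \<bullet> E\<^sub>n = r * cos \<theta>"
    by (simp add: inner_diff_left inner_add_left dot_square_norm)
  moreover have "norm (z - ?a) = r"
    using sphere by (simp only: mem_sphere dist_norm norm_minus_commute)
  ultimately have "sgn (z - ?a) \<bullet> E\<^sub>n = cos \<theta>"
    using assms by (simp only: sgn_div_norm inner_scaleR_left) simp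
  \<comment> \<open>The radial direction settles existence, and uniqueness carries its computed
    angle over to every normal.\<close>
  then show "(\<exists>\<nu>. outward_unit_normal (ball ?a r) z \<nu>) \<and>
      (\<forall>\<nu>. outward_unit_normal (ball ?a r) z \<nu> \<longrightarrow> \<nu> \<bullet> E\<^sub>n = cos \<theta>)"
    using outward_unit_normal_ball[OF assms sphere] outward_unit_normal_unique by blast
qed

theorem proposition3p2:
  fixes \<theta> r :: real
  assumes "0 < \<theta>" and "\<theta> < pi" and "r > 0"
  shows "wulff_ball (capillary_gauge \<theta>) r = ball (- (r * cos \<theta>) *\<^sub>R (E\<^sub>n :: real ^ 'n::{finite,linorder})) r
    \<and> contact_angle (wulff_ball (capillary_gauge \<theta>) r :: (real ^ 'n::{finite,linorder}) set) \<theta>"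
proof -
  \<comment> \<open>Cosine decreases strictly from 1 at 0 to -1 at \<open>pi\<close>, and
    \<open>\<theta>\<close> lies strictly between.\<close>
  have "\<bar>cos \<theta>\<bar> < 1"
    using cos_monotone_0_pi[of 0 \<theta>] cos_monotone_0_pi[of \<theta> pi] assms by simp
  then show ?thesis
    using assms(3) by (simp only: wulff_ball_capillary_gauge contact_angle_ball simp_thms)
qed

end
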